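(* Consider a triple $(X,G,\mathrm{int})$ where $X$ is a set of musical elements, $G$ is a group (the group of intervals) with operation $*$, and $\mathrm{int}$ is a function $X\times X\to G$ such that for all $x$, $y$, and $z$ in $X$, $\mathrm{int}(y,z)*\mathrm{int}(x,y)=\mathrm{int}(x,z)$. This defines the data of a category $\mathbf{C}$ along with a functor $\mathbf{C}\to\mathbf{G}$.
   Context: For a group $G$ with operation $*$, $\mathbf{G}$ denotes the group $G$ considered as a single-object category: its morphisms are the elements of $G$, and the composite of $g$ followed by $h$ is $h*g$. The set $X$ is an arbitrary set; the phrase "musical elements" indicates only its intended interpretation, and "group of intervals" is only a name for $G$. *)

theory Defs
  imports "HOL-Algebra.Group"
begin

text \<open>Composition is written in function order: \<open>Comp C g f\<close> is \<open>f\<close> followed by \<open>g\<close>.\<close>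

record ('o, 'm) precategory =
  Ob :: "'o set"
  Mor :: "'m set"
  Dom :: "'m \<Rightarrow> 'o"
  Cod :: "'m \<Rightarrow> 'o"
  Id :: "'o \<Rightarrow> 'm"
  Comp :: "'m \<Rightarrow> 'm \<Rightarrow> 'm"

locale category =
  fixes C :: "('o, 'm) precategory"
  assumes Dom_closed: "f \<in> Mor C \<Longrightarrow> Dom C f \<in> Ob C"
    and Cod_closed: "f \<in> Mor C \<Longrightarrow> Cod C f \<in> Ob C"
    and Id_closed: "x \<in> Ob C \<Longrightarrow> Id C x \<in> Mor C"
    and Dom_Id: "x \<in> Ob C \<Longrightarrow> Dom C (Id C x) = x"
    and Cod_Id: "x \<in> Ob C \<Longrightarrow> Cod C (Id C x) = x"
    and Comp_closed:
      "\<lbrakk>f \<in> Mor C; g \<in> Mor C; Cod C f = Dom C g\<rbrakk> \<Longrightarrow> Comp C g f \<in> Mor C"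
    and Dom_Comp:
      "\<lbrakk>f \<in> Mor C; g \<in> Mor C; Cod C f = Dom C g\<rbrakk> \<Longrightarrow> Dom C (Comp C g f) = Dom C f"
    and Cod_Comp:
      "\<lbrakk>f \<in> Mor C; g \<in> Mor C; Cod C f = Dom C g\<rbrakk> \<Longrightarrow> Cod C (Comp C g f) = Cod C g"
    and Comp_Id_right: "f \<in> Mor C \<Longrightarrow> Comp C f (Id C (Dom C f)) = f"
    and Comp_Id_left: "f \<in> Mor C \<Longrightarrow> Comp C (Id C (Cod C f)) f = f"
    and Comp_assoc:
      "\<lbrakk>f \<in> Mor C; g \<in> Mor C; h \<in> Mor C; Cod C f = Dom C g; Cod C g = Dom C h\<rbrakk>
        \<Longrightarrow> Comp C h (Comp C g f) = Comp C (Comp C h g) f"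

locale category_functor =
  source: category C + target: category D
  for C :: "('o, 'm) precategory" and D :: "('p, 'n) precategory" +
  fixes F_Ob :: "'o \<Rightarrow> 'p" and F_Mor :: "'m \<Rightarrow> 'n"
  assumes F_Ob_closed: "x \<in> Ob C \<Longrightarrow> F_Ob x \<in> Ob D"
    and F_Mor_closed: "f \<in> Mor C \<Longrightarrow> F_Mor f \<in> Mor D"
    and F_Dom: "f \<in> Mor C \<Longrightarrow> Dom D (F_Mor f) = F_Ob (Dom C f)"
    and F_Cod: "f \<in> Mor C \<Longrightarrow> Cod D (F_Mor f) = F_Ob (Cod C f)"
    and F_Id: "x \<in> Ob C \<Longrightarrow> F_Mor (Id C x) = Id D (F_Ob x)"
    and F_Comp:
      "\<lbrakk>f \<in> Mor C; g \<in> Mor C; Cod C f = Dom C g\<rbrakk>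
        \<Longrightarrow> F_Mor (Comp C g f) = Comp D (F_Mor g) (F_Mor f)"

definition group_category :: "('g, 'b) monoid_scheme \<Rightarrow> (unit, 'g) precategory" where
  "group_category G =
    \<lparr>Ob = {()}, Mor = carrier G, Dom = (\<lambda>_. ()), Cod = (\<lambda>_. ()),
     Id = (\<lambda>_. \<one>\<^bsub>G\<^esub>), Comp = (\<lambda>h g. h \<otimes>\<^bsub>G\<^esub> g)\<rparr>"

text \<open>The category with object set \<open>X\<close> and exactly one morphism \<open>x \<rightarrow> y\<close> for all
  \<open>x, y \<in> X\<close>, namely the pair \<open>(x, y)\<close>. A function on \<open>X \<times> X\<close> is thus a function on
  its morphisms.\<close>

definition pair_category :: "'a set \<Rightarrow> ('a, 'a \<times> 'a) precategory" where
  "pair_category X =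
    \<lparr>Ob = X, Mor = X \<times> X, Dom = fst, Cod = snd,
     Id = (\<lambda>x. (x, x)), Comp = (\<lambda>g f. (fst f, snd g))\<rparr>"

end

theory Submission
  imports Defs
begin

text \<open>Take for C the indiscrete category on \<open>X\<close>. Since (x, y) followed by (y, z)
  is (x, z), the interval identity is exactly preservation of composition, in the order used by
  \<open>group_category\<close>. Identities remain: setting x = y = z makes
  \<open>intvl (x, x)\<close> idempotent, and cancellation in a group forces it to be
  \<open>\<one>\<close>.\<close>

lemma category_pair_category: "category (pair_category X)"
  by unfold_locales (auto simp: pair_category_def)

lemma category_group_category:
  assumes "group G"
  shows "category (group_category G)"
proof -
  interpret group G by fact
  show ?thesis
    by unfold_locales (auto simp: group_category_def m_assoc)
qed

theorem proposition1:
  fixes X :: "'a set"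
    and G :: "('g, 'b) monoid_scheme" (structure)
    and intvl :: "'a \<times> 'a \<Rightarrow> 'g"
  assumes "group G"
    and "intvl \<in> X \<times> X \<rightarrow> carrier G"
    and "\<forall>x\<in>X. \<forall>y\<in>X. \<forall>z\<in>X. intvl (y, z) \<otimes> intvl (x, y) = intvl (x, z)"
  shows "category (pair_category X) \<and>
    category_functor (pair_category X) (group_category G) (\<lambda>_. ()) intvl"
proof
  interpret group G by fact
  show "category (pair_category X)"
    by (rule category_pair_category)
  \<comment> \<open>\<open>intvl (x, x)\<close> is idempotent, and a group has no idempotent but \<open>\<one>\<close>.\<close>
  have intvl_refl: "intvl (x, x) = \<one>" if "x \<in> X" for x
  proof -
    have "intvl (x, x) \<in> carrier G" "intvl (x, x) \<otimes> intvl (x, x) = intvl (x, x)"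
      using assms(2,3) that by auto
    then show ?thesis
      using l_cancel_one by blast
  qed
  \<comment> \<open>\<open>assms(2)\<close> gives closure on morphisms, \<open>assms(3)\<close>
    gives \<open>F_Comp\<close> and \<open>intvl_refl\<close> gives \<open>F_Id\<close>; the
    conditions on objects, domains and codomains are trivial because the target has one
    object.\<close>
  show "category_functor (pair_category X) (group_category G) (\<lambda>_. ()) intvl"
    using assms(2,3) intvl_refl
    by (intro category_functor.intro category_functor_axioms.intro
        category_pair_category category_group_category[OF assms(1)])
      (auto simp: pair_category_def group_category_def)
qed

end
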